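(* The preorder $\leq_{\mathsf{c}}$ contains antichains of size $2^\omega$, i.e. there is an injection $\psi:2^\omega\to\mathscr{P}(\omega^\omega)$ such that $\psi(x)$ and $\psi(y)$ are $\leq_{\mathsf{c}}$-incomparable whenever $x\neq y$. In fact, such an antichain can be found inside every $\mathsf{L}$-selfdual degree: for every $\mathsf{L}$-selfdual $A\subseteq\omega^\omega$ there is an injection $\psi:2^\omega\to[A]_{\mathsf{L}}$ such that $\psi(x)$ and $\psi(y)$ are $\leq_{\mathsf{c}}$-incomparable whenever $x\neq y$.
   Context: Base theory: $\mathsf{ZF}+\mathsf{DC}(\mathbb{R})$ (no determinacy is assumed). $2^\omega$ denotes the set of infinite binary sequences. $\omega^\omega$ is the Baire space with the standard metric $d(x,y)=0$ if $x=y$ and $d(x,y)=2^{-n}$ if $x\neq y$ and $n$ is least with $x(n)\neq y(n)$. A function $f:\omega^\omega\to\omega^\omega$ is a contraction if there is a constant $0\leq L<1$ with $d(f(x),f(y))\leq L\cdot d(x,y)$ for all $x,y$, and is nonexpansive if $d(f(x),f(y))\leq d(x,y)$ for all $x,y$. $\mathsf{c}$ and $\mathsf{L}$ are the sets of all contractions and of all nonexpansive functions, respectively. For $A,B\subseteq\omega^\omega$: $A\leq_{\mathsf{c}}B$ iff $A=B$ or $A=f^{-1}(B)$ for some $f\in\mathsf{c}$; $A\leq_{\mathsf{L}}B$ iff $A=f^{-1}(B)$ for some $f\in\mathsf{L}$; $A\equiv_{\mathsf{L}}B$ iff $A\leq_{\mathsf{L}}B\leq_{\mathsf{L}}A$;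 $[A]_{\mathsf{L}}=\{B\subseteq\omega^\omega: B\equiv_{\mathsf{L}}A\}$. $A$ (equivalently its degree $[A]_{\mathsf{L}}$) is $\mathsf{L}$-selfdual if $A\leq_{\mathsf{L}}\omega^\omega\setminus A$. *)

theory Defs
  imports Complex_Main
begin

type_synonym baire = "nat \<Rightarrow> nat"

text \<open>
  The standard ultrametric on Baire space. It differs from the \<open>dist\<close> that the library puts on
  function types with countable domain, and contractivity depends on the choice of metric.
\<close>

definition baire_dist :: "baire \<Rightarrow> baire \<Rightarrow> real" where
  "baire_dist x y = (if x = y then 0 else (1 / 2) ^ (LEAST n. x n \<noteq> y n))"

definition contraction :: "(baire \<Rightarrow> baire) \<Rightarrow> bool" where
  "contraction f \<longleftrightarrow>
     (\<exists>L. 0 \<le> L \<and> L < 1 \<and> (\<forall>x y. baire_dist (f x) (f y) \<le> L * baire_dist x y))"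

definition nonexpansive :: "(baire \<Rightarrow> baire) \<Rightarrow> bool" where
  "nonexpansive f \<longleftrightarrow> (\<forall>x y. baire_dist (f x) (f y) \<le> baire_dist x y)"

text \<open>
  The identity is not a contraction, so reflexivity is built into \<open>c_le\<close>.
\<close>

definition c_le :: "baire set \<Rightarrow> baire set \<Rightarrow> bool" (infix "\<le>\<^sub>c" 50) where
  "A \<le>\<^sub>c B \<longleftrightarrow> A = B \<or> (\<exists>f. contraction f \<and> A = f -` B)"

definition L_le :: "baire set \<Rightarrow> baire set \<Rightarrow> bool" (infix "\<le>\<^sub>L" 50) where
  "A \<le>\<^sub>L B \<longleftrightarrow> (\<exists>f. nonexpansive f \<and> A = f -` B)"

definition L_equiv :: "baire set \<Rightarrow> baire set \<Rightarrow> bool" (infix "\<equiv>\<^sub>L" 50) where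
  "A \<equiv>\<^sub>L B \<longleftrightarrow> A \<le>\<^sub>L B \<and> B \<le>\<^sub>L A"

definition L_degree :: "baire set \<Rightarrow> baire set set" where
  "L_degree A = {B. B \<equiv>\<^sub>L A}"

definition L_selfdual :: "baire set \<Rightarrow> bool" where
  "L_selfdual A \<longleftrightarrow> A \<le>\<^sub>L - A"

definition c_incomparable :: "baire set \<Rightarrow> baire set \<Rightarrow> bool" where
  "c_incomparable A B \<longleftrightarrow> \<not> A \<le>\<^sub>c B \<and> \<not> B \<le>\<^sub>c A"

end

theory Submission imports Defs begin

text \<open>
  If \<open>A\<close> is \<open>L\<close>-selfdual and \<open>B\<close>, \<open>C\<close> are in its degree, then a contraction reducing \<open>B\<close> to \<open>C\<close>
  composes with \<open>C \<le>\<^sub>L A \<le>\<^sub>L - A \<le>\<^sub>L - B\<close> to a contraction reducing \<open>B\<close> to its complement, whose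
  fixed point would lie in \<open>B\<close> iff it does not. So distinct sets in the degree are always
  \<open>c\<close>-incomparable, and it suffices to find continuum many of them: copy \<open>A\<close> into the cylinders
  with even first entry and fill each cylinder with odd first entry either completely or not at
  all. As \<open>A\<close> is neither empty nor everything, constant maps reduce the odd cylinders to \<open>A\<close>.
\<close>

text \<open>Reduces the metric to finite information: if the outputs first differ at
  \<open>m\<close>, the inputs must already differ at some place up to \<open>m\<close>.\<close>

lemma nonexpansiveI:
  assumes "\<And>x y n. (\<And>i. i \<le> n \<Longrightarrow> x i = y i) \<Longrightarrow> f x n = f y n"
  shows "nonexpansive f"
  unfolding nonexpansive_def
proof (intro allI)
  fix x y
  show "baire_dist (f x) (f y) \<le> baire_dist x y"
  proof (cases "f x = f y")
    case True
    then show ?thesis by (simp add: baire_dist_def)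
  next
    case False
    then have "x \<noteq> y" by metis
    define m where "m = (LEAST n. f x n \<noteq> f y n)"
    define k where "k = (LEAST n. x n \<noteq> y n)"
    have "\<exists>n. f x n \<noteq> f y n"
      using False by (simp add: fun_eq_iff)
    then have "f x m \<noteq> f y m"
      unfolding m_def by (rule LeastI_ex)
    then obtain i where "i \<le> m" "x i \<noteq> y i"
      using assms[of m x y] by metis
    moreover have "k \<le> i"
      unfolding k_def using \<open>x i \<noteq> y i\<close> by (rule Least_le)
    ultimately have "(1 / 2 :: real) ^ m \<le> (1 / 2) ^ k"
      by (simp add: power_decreasing)
    then show ?thesis
      using False \<open>x \<noteq> y\<close> by (simp add: baire_dist_def m_def k_def)
  qed
qed

text \<open>Distances are powers of 1/2, so shrinking by a factor below 1 pushes the first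
  difference at least one place further out; hence \<open>i < n\<close> for the inputs but
  \<open>i \<le> n\<close> for the outputs.\<close>

lemma contraction_agree:
  assumes "contraction f" and agree: "\<And>i. i < n \<Longrightarrow> x i = y i" and "i \<le> n"
  shows "f x i = f y i"
proof (rule ccontr)
  assume neq: "f x i \<noteq> f y i"
  then have "f x \<noteq> f y" "x \<noteq> y"
    by metis+
  obtain L where "L < 1" and L: "\<forall>x y. baire_dist (f x) (f y) \<le> L * baire_dist x y"
    using \<open>contraction f\<close> unfolding contraction_def by metis
  define m where "m = (LEAST n. f x n \<noteq> f y n)"
  define k where "k = (LEAST n. x n \<noteq> y n)"
  have "\<exists>n. x n \<noteq> y n"
    using \<open>x \<noteq> y\<close> by (simp add: fun_eq_iff)
  then have "x k \<noteq> y k"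
    unfolding k_def by (rule LeastI_ex)
  then have "n \<le> k"
    using agree not_le by blast
  moreover have "m \<le> i"
    unfolding m_def using neq by (rule Least_le)
  ultimately have "m \<le> k"
    using \<open>i \<le> n\<close> by linarith
  have "(1 / 2 :: real) ^ m \<le> L * (1 / 2) ^ k"
    using L[rule_format, of x y] \<open>f x \<noteq> f y\<close> \<open>x \<noteq> y\<close> by (simp add: baire_dist_def m_def k_def)
  also have "\<dots> < (1 / 2) ^ k"
    using \<open>L < 1\<close> by simp
  also have "\<dots> \<le> (1 / 2) ^ m"
    using \<open>m \<le> k\<close> by (simp add: power_decreasing)
  finally show False by simp
qed

text \<open>Banach's theorem done entrywise: each application of \<open>f\<close> gains one entry of
  agreement, so the iterates from the zero sequence stabilise at every place.\<close>

lemma contraction_fixpoint: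
  assumes "contraction f"
  obtains p where "f p = p"
proof -
  define u where "u k = (f ^^ k) (\<lambda>_. 0)" for k
  have u_Suc: "u (Suc k) = f (u k)" for k
    by (simp add: u_def)
  have step: "u k i = u (Suc k) i" if "i < k" for k i
    using that
  proof (induction k arbitrary: i)
    case (Suc k)
    then show ?case
      using contraction_agree[OF assms, of k "u k" "u (Suc k)" i] by (simp add: u_Suc)
  qed simp
  \<comment> \<open>\<open>Suc k\<close> is the first stage at which entry \<open>k\<close> is
    guaranteed final.\<close>
  define p where "p k = u (Suc k) k" for k
  have p: "p i = u k i" if "i < k" for i k
    using that
  proof (induction k)
    case (Suc k)
    then show ?case
      using step[of i k] by (cases "i = k") (auto simp: p_def)
  qed simp
  \<comment> \<open>\<open>p\<close> and \<open>u k\<close> agree below \<open>k\<close>, so their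
    images agree at \<open>k\<close> as well, and \<open>f (u k)\<close> is
    \<open>u (Suc k)\<close>.\<close>
  have "f p k = p k" for k
    using contraction_agree[OF assms, of k p "u k" k] p by (simp add: p_def u_Suc)
  then show thesis using that by blast
qed

lemma nonexpansive_comp:
  assumes "nonexpansive g" "nonexpansive f"
  shows "nonexpansive (g \<circ> f)"
  using assms unfolding nonexpansive_def comp_def by (meson order_trans)

lemma nonexpansive_comp_contraction:
  assumes "nonexpansive g" "contraction f"
  shows "contraction (g \<circ> f)"
proof -
  obtain L where L: "0 \<le> L" "L < 1" "\<And>x y. baire_dist (f x) (f y) \<le> L * baire_dist x y"
    using assms(2) unfolding contraction_def by metis
  have "baire_dist (g (f x)) (g (f y)) \<le> L * baire_dist x y" for x y
    using assms(1) L(3)[of x y] unfolding nonexpansive_def by (meson order_trans)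
  then show ?thesis
    using L(1,2) unfolding contraction_def comp_def by blast
qed

lemma L_le_trans:
  assumes "A \<le>\<^sub>L B" "B \<le>\<^sub>L C"
  shows "A \<le>\<^sub>L C"
  using assms unfolding L_le_def by (metis nonexpansive_comp vimage_comp)

lemma L_le_Compl:
  assumes "A \<le>\<^sub>L B"
  shows "- A \<le>\<^sub>L - B"
  using assms unfolding L_le_def by (metis vimage_Compl)

lemma L_selfdual_degree:
  assumes "L_selfdual A" "B \<in> L_degree A" "C \<in> L_degree A" "B \<noteq> C"
  shows "\<not> B \<le>\<^sub>c C"
proof
  assume "B \<le>\<^sub>c C"
  then obtain f where f: "contraction f" "B = f -` C"
    using \<open>B \<noteq> C\<close> by (auto simp: c_le_def)
  have "C \<le>\<^sub>L A" "A \<le>\<^sub>L - A" "A \<le>\<^sub>L B"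
    using assms by (auto simp: L_degree_def L_equiv_def L_selfdual_def)
  then have "C \<le>\<^sub>L - B"
    by (meson L_le_Compl L_le_trans)
  then obtain g where g: "nonexpansive g" "C = g -` (- B)"
    by (auto simp: L_le_def)
  obtain p where "(g \<circ> f) p = p"
    by (rule contraction_fixpoint[OF nonexpansive_comp_contraction[OF g(1) f(1)]])
  \<comment> \<open>\<open>p \<in> B\<close> iff \<open>f p \<in> C\<close> iff
    \<open>g (f p) \<notin> B\<close>, and \<open>g (f p)\<close> is \<open>p\<close>.\<close>
  then have "p \<in> B \<longleftrightarrow> p \<notin> B"
    using f(2) g(2) by (metis ComplD ComplI comp_apply vimage_eq)
  then show False
    by blast
qed

text \<open>Entry 0 is recoded in place instead of prepending a tag: deleting a tag would shift the
  sequence and double distances, so decoding would not be nonexpansive.\<close>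

definition interleave :: "baire set \<Rightarrow> (nat \<Rightarrow> bool) \<Rightarrow> baire set" where
  "interleave A z = {x. if even (x 0) then x(0 := x 0 div 2) \<in> A else z (x 0 div 2)}"

lemma inj_interleave: "inj (interleave A)"
proof (rule injI, rule ext)
  fix z w n
  assume "interleave A z = interleave A w"
  \<comment> \<open>Any point of the cylinder with first entry \<open>2 * n + 1\<close> reads off
    bit \<open>n\<close>.\<close>
  then have "(\<lambda>_. 2 * n + 1) \<in> interleave A z \<longleftrightarrow> (\<lambda>_. 2 * n + 1) \<in> interleave A w"
    by simp
  then show "z n = w n"
    by (simp add: interleave_def)
qed

lemma interleave_in_L_degree:
  assumes "A \<noteq> {}" "A \<noteq> UNIV"
  shows "interleave A z \<in> L_degree A"
proof -
  obtain p q where pq: "p \<in> A" "q \<notin> A"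
    using assms by auto
  define f where "f x = (if even (x 0) then x(0 := x 0 div 2)
    else if z (x 0 div 2) then p else q)" for x
  \<comment> \<open>Entry \<open>n\<close> of \<open>f x\<close> depends only on \<open>x 0\<close>
    and \<open>x n\<close>.\<close>
  have "nonexpansive f"
    by (rule nonexpansiveI) (auto simp: f_def)
  moreover have "interleave A z = f -` A"
    using pq by (auto simp: interleave_def f_def split: if_splits)
  ultimately have "interleave A z \<le>\<^sub>L A"
    unfolding L_le_def by blast
  moreover have "A \<le>\<^sub>L interleave A z"
    unfolding L_le_def
  proof (intro exI conjI)
    show "nonexpansive (\<lambda>x. x(0 := 2 * x 0))"
      by (rule nonexpansiveI) auto
    show "A = (\<lambda>x. x(0 := 2 * x 0)) -` interleave A z"
      by (auto simp: interleave_def)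
  qed
  ultimately show ?thesis
    by (simp add: L_degree_def L_equiv_def)
qed

lemma L_selfdual_antichain:
  assumes "L_selfdual A"
  shows "\<exists>\<psi> :: (nat \<Rightarrow> bool) \<Rightarrow> baire set. inj \<psi> \<and> range \<psi> \<subseteq> L_degree A
    \<and> (\<forall>x y. x \<noteq> y \<longrightarrow> c_incomparable (\<psi> x) (\<psi> y))"
proof (intro exI conjI)
  \<comment> \<open>Preimages of the empty set are empty and preimages of the whole space are whole,
    so neither set reduces to its complement.\<close>
  have "A \<noteq> {}" "A \<noteq> UNIV"
    using assms by (auto simp: L_selfdual_def L_le_def)
  then have deg: "interleave A z \<in> L_degree A" for z
    by (rule interleave_in_L_degree)
  then show "range (interleave A) \<subseteq> L_degree A"
    by blast
  show "\<forall>x y. x \<noteq> y \<longrightarrow> c_incomparable (interleave A x) (interleave A y)"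
    using L_selfdual_degree[OF assms deg deg] inj_eq[OF inj_interleave]
    by (simp add: c_incomparable_def)
qed (rule inj_interleave)

text \<open>Supplies one selfdual degree, from which the unrestricted antichain is taken; changing
  entry 0 alone carries the cylinder and its complement into each other.\<close>

lemma L_selfdual_cylinder: "L_selfdual {x. x 0 = 0}"
  unfolding L_selfdual_def L_le_def
proof (intro exI conjI)
  let ?f = "\<lambda>x :: baire. x(0 := if x 0 = 0 then 1 else 0)"
  show "nonexpansive ?f"
    by (rule nonexpansiveI) auto
  show "{x. x 0 = 0} = ?f -` (- {x. x 0 = 0})"
    by (auto split: if_splits)
qed

theorem corollary4p8:
  shows "(\<exists>\<psi> :: (nat \<Rightarrow> bool) \<Rightarrow> baire set.
            inj \<psi> \<and> (\<forall>x y. x \<noteq> y \<longrightarrow> c_incomparable (\<psi> x) (\<psi> y)))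
    \<and> (\<forall>A :: baire set. L_selfdual A \<longrightarrow>
         (\<exists>\<psi> :: (nat \<Rightarrow> bool) \<Rightarrow> baire set.
            inj \<psi> \<and> range \<psi> \<subseteq> L_degree A
            \<and> (\<forall>x y. x \<noteq> y \<longrightarrow> c_incomparable (\<psi> x) (\<psi> y))))"
proof (rule conjI)
  show "\<exists>\<psi> :: (nat \<Rightarrow> bool) \<Rightarrow> baire set.
      inj \<psi> \<and> (\<forall>x y. x \<noteq> y \<longrightarrow> c_incomparable (\<psi> x) (\<psi> y))"
    using L_selfdual_antichain[OF L_selfdual_cylinder] by (elim exE conjE) (intro exI conjI)
qed (intro allI impI L_selfdual_antichain)

end
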